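(* Let $M_0$ be a finite-dimensional complex symmetric Leibniz algebra of rank $1$. Then $M_0$ has an ideal of codimension at most $1$ that is isomorphic to $\tilde{M}(L_1,L_2,R,\alpha,\pi)$ for some data $(L_1,L_2,R,\alpha,\pi)$ satisfying the assumptions (a), (b), (c) listed in the context.
   Context: All algebras are finite-dimensional over $\mathbb{C}$. A left Leibniz algebra is a $\mathbb{C}$-algebra $M$ with product $[\ ]$ satisfying $[a[bc]]=[[ab]c]+[b[ac]]$ for all $a,b,c\in M$; a right Leibniz algebra is one for which each map $b\mapsto[ba]$ is a derivation. A symmetric Leibniz algebra is an algebra that is both a left and a right Leibniz algebra. The Leibniz kernel $C(M)$ is the span of all $[aa]$, $a\in M$, and the rank of $M$ is $\dim C(M)$. Ideal means $2$-sided ideal. Assumptions on the data $(L_1,L_2,R,\alpha,\pi)$: (a) $L_1,L_2$ are Lie algebras with a common ideal $R$ (i.e. $R$ is a Lie algebra that is an ideal of both), and $L_2/R$ is abelian. Set $Z:=R\cap Z(L_1)\cap Z(L_2)$, where $Z(L_i)$ is the center of $L_i$. (b) $\alpha:L_1\to \mathrm{Der}(L_2)$ is a morphism of Lie algebras; write $\alpha(x)(y)=x.y$ for $x\in L_1$, $y\in L_2$. It is required that $x.y=[xy]$ whenever $x\in R$ (bracket in $L_2$) or $y\in R$ (bracket in $L_1$). (c) $\pi:L_1/R\to \mathrm{Hom}_{\mathbb{C}}(L_2/R,Z)$ is an injective morphism of left $L_1$-modules such that no nonzero element of $L_2/R$ is annihilated by all of $\mathrm{im}\,\pi$. Here $L_1$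 acts on $L_1/R$ by the adjoint action, on $L_2/R$ via $\alpha$, trivially on $Z$, and on $\mathrm{Hom}_{\mathbb{C}}(L_2/R,Z)$ by the induced action $(x.f)(v)=-f(x.v)$. Set $\psi'(x,y):=\pi(x+R)(y+R)\in Z$ for $x\in L_1$, $y\in L_2$. Let $M=M(L_1,L_2,R,\alpha,\pi)$ be the vector space $L_1\oplus L_2$ with product $$[(x_1,y_1)(x_2,y_2)]:=\big([x_1x_2],\ x_1.y_2-x_2.y_1+[y_1y_2]+\psi'(x_2,y_1)\big).$$ Then $D:=\{(a,-a)\mid a\in R\}$ is a $2$-sided ideal of $M$, and $\tilde{M}(L_1,L_2,R,\alpha,\pi):=M/D$, a left Leibniz algebra. *)

theory Defs
  imports "HOL-Analysis.Analysis" "HOL-Library.Set_Algebras"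
begin

text \<open>
  An algebra is given by a subspace \<open>V\<close> of an ambient complex vector space with scalar
  multiplication \<open>s\<close>, together with a product \<open>br\<close> of which only the values on \<open>V\<close> matter.
\<close>

definition algebra_on ::
  "(complex \<Rightarrow> 'a::ab_group_add \<Rightarrow> 'a) \<Rightarrow> 'a set \<Rightarrow> ('a \<Rightarrow> 'a \<Rightarrow> 'a) \<Rightarrow> bool" where
  "algebra_on s V br \<longleftrightarrow>
     vector_space s \<and> module.subspace s V \<and> (\<exists>B. finite B \<and> V = module.span s B) \<and>
     (\<forall>x\<in>V. \<forall>y\<in>V. br x y \<in> V) \<and>
     (\<forall>x\<in>V. \<forall>y\<in>V. \<forall>z\<in>V. br (x + y) z = br x z + br y z \<and> br x (y + z) = br x y + br x z) \<and>
     (\<forall>c. \<forall>x\<in>V. \<forall>y\<in>V. br (s c x) y = s c (br x y) \<and> br x (s c y) = s c (br x y))"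

definition derivations ::
  "(complex \<Rightarrow> 'a::ab_group_add \<Rightarrow> 'a) \<Rightarrow> 'a set \<Rightarrow> ('a \<Rightarrow> 'a \<Rightarrow> 'a) \<Rightarrow> ('a \<Rightarrow> 'a) set" where
  "derivations s V br =
     {d. (\<forall>x\<in>V. d x \<in> V) \<and> (\<forall>x\<in>V. \<forall>y\<in>V. d (x + y) = d x + d y) \<and>
         (\<forall>c. \<forall>x\<in>V. d (s c x) = s c (d x)) \<and>
         (\<forall>x\<in>V. \<forall>y\<in>V. d (br x y) = br (d x) y + br x (d y))}"

definition left_leibniz_algebra ::
  "(complex \<Rightarrow> 'a::ab_group_add \<Rightarrow> 'a) \<Rightarrow> 'a set \<Rightarrow> ('a \<Rightarrow> 'a \<Rightarrow> 'a) \<Rightarrow> bool" where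
  "left_leibniz_algebra s V br \<longleftrightarrow> algebra_on s V br \<and>
     (\<forall>a\<in>V. \<forall>b\<in>V. \<forall>c\<in>V. br a (br b c) = br (br a b) c + br b (br a c))"

definition right_leibniz_algebra ::
  "(complex \<Rightarrow> 'a::ab_group_add \<Rightarrow> 'a) \<Rightarrow> 'a set \<Rightarrow> ('a \<Rightarrow> 'a \<Rightarrow> 'a) \<Rightarrow> bool" where
  "right_leibniz_algebra s V br \<longleftrightarrow> algebra_on s V br \<and>
     (\<forall>a\<in>V. (\<lambda>b. br b a) \<in> derivations s V br)"

definition symmetric_leibniz_algebra ::
  "(complex \<Rightarrow> 'a::ab_group_add \<Rightarrow> 'a) \<Rightarrow> 'a set \<Rightarrow> ('a \<Rightarrow> 'a \<Rightarrow> 'a) \<Rightarrow> bool" where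
  "symmetric_leibniz_algebra s V br \<longleftrightarrow>
     left_leibniz_algebra s V br \<and> right_leibniz_algebra s V br"

definition leibniz_kernel ::
  "(complex \<Rightarrow> 'a::ab_group_add \<Rightarrow> 'a) \<Rightarrow> 'a set \<Rightarrow> ('a \<Rightarrow> 'a \<Rightarrow> 'a) \<Rightarrow> 'a set" where
  "leibniz_kernel s V br = module.span s {br a a | a. a \<in> V}"

definition leibniz_rank ::
  "(complex \<Rightarrow> 'a::ab_group_add \<Rightarrow> 'a) \<Rightarrow> 'a set \<Rightarrow> ('a \<Rightarrow> 'a \<Rightarrow> 'a) \<Rightarrow> nat" where
  "leibniz_rank s V br = vector_space.dim s (leibniz_kernel s V br)"

definition lie_algebra_on ::
  "(complex \<Rightarrow> 'a::ab_group_add \<Rightarrow> 'a) \<Rightarrow> 'a set \<Rightarrow> ('a \<Rightarrow> 'a \<Rightarrow> 'a) \<Rightarrow> bool" where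
  "lie_algebra_on s L br \<longleftrightarrow> algebra_on s L br \<and> (\<forall>x\<in>L. br x x = 0) \<and>
     (\<forall>x\<in>L. \<forall>y\<in>L. \<forall>z\<in>L. br x (br y z) + br y (br z x) + br z (br x y) = 0)"

definition ideal_on ::
  "(complex \<Rightarrow> 'a::ab_group_add \<Rightarrow> 'a) \<Rightarrow> 'a set \<Rightarrow> ('a \<Rightarrow> 'a \<Rightarrow> 'a) \<Rightarrow> 'a set \<Rightarrow> bool" where
  "ideal_on s V br I \<longleftrightarrow> module.subspace s I \<and> I \<subseteq> V \<and>
     (\<forall>x\<in>V. \<forall>i\<in>I. br x i \<in> I \<and> br i x \<in> I)"

definition lie_center :: "'a::ab_group_add set \<Rightarrow> ('a \<Rightarrow> 'a \<Rightarrow> 'a) \<Rightarrow> 'a set" where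
  "lie_center L br = {z \<in> L. \<forall>x\<in>L. br z x = 0}"

text \<open>
  Quotients are not subspaces of the ambient space, so isomorphisms are stated
  between records that carry all operations explicitly.
\<close>

record 'a calg =
  car :: "'a set"
  zer :: 'a
  add :: "'a \<Rightarrow> 'a \<Rightarrow> 'a"
  scl :: "complex \<Rightarrow> 'a \<Rightarrow> 'a"
  mul :: "'a \<Rightarrow> 'a \<Rightarrow> 'a"

definition alg_of ::
  "(complex \<Rightarrow> 'a::ab_group_add \<Rightarrow> 'a) \<Rightarrow> 'a set \<Rightarrow> ('a \<Rightarrow> 'a \<Rightarrow> 'a) \<Rightarrow> 'a calg" where
  "alg_of s V br = \<lparr>car = V, zer = 0, add = (+), scl = s, mul = br\<rparr>"

text \<open>
  The elements of the quotient \<open>V/I\<close> are the cosets \<open>v +o I\<close>. Adding \<open>I\<close> in the last two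
  operations turns the elementwise image into the full coset; it is needed for instance
  when the scalar is \<open>0\<close>.
\<close>

definition quot_alg ::
  "(complex \<Rightarrow> 'a::ab_group_add \<Rightarrow> 'a) \<Rightarrow> 'a set \<Rightarrow> ('a \<Rightarrow> 'a \<Rightarrow> 'a) \<Rightarrow> 'a set \<Rightarrow> 'a set calg" where
  "quot_alg s V br I =
     \<lparr>car = {v +o I | v. v \<in> V}, zer = I, add = (\<lambda>X Y. X + Y),
      scl = (\<lambda>c X. s c ` X + I),
      mul = (\<lambda>X Y. {br x y | x y. x \<in> X \<and> y \<in> Y} + I)\<rparr>"

definition abelian_alg :: "'a calg \<Rightarrow> bool" where
  "abelian_alg A \<longleftrightarrow> (\<forall>x\<in>car A. \<forall>y\<in>car A. mul A x y = zer A)"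

definition alg_isomorphic :: "'a calg \<Rightarrow> 'b calg \<Rightarrow> bool" where
  "alg_isomorphic A B \<longleftrightarrow> (\<exists>f. bij_betw f (car A) (car B) \<and>
     (\<forall>x\<in>car A. \<forall>y\<in>car A. f (add A x y) = add B (f x) (f y)) \<and>
     (\<forall>c. \<forall>x\<in>car A. f (scl A c x) = scl B c (f x)) \<and>
     (\<forall>x\<in>car A. \<forall>y\<in>car A. f (mul A x y) = mul B (f x) (f y)))"

definition linear_maps ::
  "(complex \<Rightarrow> 'a::ab_group_add \<Rightarrow> 'a) \<Rightarrow> 'b calg \<Rightarrow> 'a set \<Rightarrow> ('b \<Rightarrow> 'a) set" where
  "linear_maps s A Z = {f. (\<forall>v\<in>car A. f v \<in> Z) \<and>
     (\<forall>v\<in>car A. \<forall>w\<in>car A. f (add A v w) = f v + f w) \<and>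
     (\<forall>c. \<forall>v\<in>car A. f (scl A c v) = s c (f v))}"

text \<open>
  The data \<open>(L1, L2, R, \<alpha>, \<pi>)\<close>. Both Lie algebras are realised inside one ambient space, so that
  the common ideal is an actual subset of both; this is no restriction, since one may pass
  to \<open>(L1 \<oplus> L2)/{(a, -a) | a \<in> R}\<close>. The intersection of \<open>L1\<close> and \<open>L2\<close> may be larger than \<open>R\<close>, and
  the two brackets are required to agree on \<open>R\<close> only. Linear maps on \<open>L2/R\<close> are compared on
  the carrier of \<open>L2/R\<close>, and module actions on \<open>L1/R\<close> and \<open>L2/R\<close> are written on representatives.
\<close>

locale leibniz_data = vector_space s
  for s :: "complex \<Rightarrow> 'a::ab_group_add \<Rightarrow> 'a" +
  fixes L1 :: "'a set" and br1 :: "'a \<Rightarrow> 'a \<Rightarrow> 'a"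
    and L2 :: "'a set" and br2 :: "'a \<Rightarrow> 'a \<Rightarrow> 'a"
    and R :: "'a set"
    and \<alpha> :: "'a \<Rightarrow> 'a \<Rightarrow> 'a"
    and \<pi> :: "'a set \<Rightarrow> 'a set \<Rightarrow> 'a"
  assumes lie1: "lie_algebra_on s L1 br1"
    and lie2: "lie_algebra_on s L2 br2"
    and ideal1: "ideal_on s L1 br1 R"
    and ideal2: "ideal_on s L2 br2 R"
    and brackets_agree: "\<And>x y. x \<in> R \<Longrightarrow> y \<in> R \<Longrightarrow> br1 x y = br2 x y"
    and abelian_quotient: "abelian_alg (quot_alg s L2 br2 R)"
    and action_derivation: "\<And>x. x \<in> L1 \<Longrightarrow> \<alpha> x \<in> derivations s L2 br2"
    and action_add: "\<And>x x' y. x \<in> L1 \<Longrightarrow> x' \<in> L1 \<Longrightarrow> y \<in> L2 \<Longrightarrow> \<alpha> (x + x') y = \<alpha> x y + \<alpha> x' y"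
    and action_scale: "\<And>c x y. x \<in> L1 \<Longrightarrow> y \<in> L2 \<Longrightarrow> \<alpha> (s c x) y = s c (\<alpha> x y)"
    and action_bracket: "\<And>x x' y. x \<in> L1 \<Longrightarrow> x' \<in> L1 \<Longrightarrow> y \<in> L2 \<Longrightarrow>
          \<alpha> (br1 x x') y = \<alpha> x (\<alpha> x' y) - \<alpha> x' (\<alpha> x y)"
    and action_left_R: "\<And>x y. x \<in> R \<Longrightarrow> y \<in> L2 \<Longrightarrow> \<alpha> x y = br2 x y"
    and action_right_R: "\<And>x y. x \<in> L1 \<Longrightarrow> y \<in> R \<Longrightarrow> \<alpha> x y = br1 x y"
    and pi_Hom: "\<And>X. X \<in> car (quot_alg s L1 br1 R) \<Longrightarrow>
          \<pi> X \<in> linear_maps s (quot_alg s L2 br2 R) (R \<inter> lie_center L1 br1 \<inter> lie_center L2 br2)"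
    and pi_add: "\<And>X X' Y. X \<in> car (quot_alg s L1 br1 R) \<Longrightarrow> X' \<in> car (quot_alg s L1 br1 R) \<Longrightarrow>
          Y \<in> car (quot_alg s L2 br2 R) \<Longrightarrow>
          \<pi> (add (quot_alg s L1 br1 R) X X') Y = \<pi> X Y + \<pi> X' Y"
    and pi_scale: "\<And>c X Y. X \<in> car (quot_alg s L1 br1 R) \<Longrightarrow> Y \<in> car (quot_alg s L2 br2 R) \<Longrightarrow>
          \<pi> (scl (quot_alg s L1 br1 R) c X) Y = s c (\<pi> X Y)"
    and pi_equivariant: "\<And>x u v. x \<in> L1 \<Longrightarrow> u \<in> L1 \<Longrightarrow> v \<in> L2 \<Longrightarrow>
          \<pi> (br1 x u +o R) (v +o R) = - \<pi> (u +o R) (\<alpha> x v +o R)"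
    and pi_injective: "\<And>X X'. X \<in> car (quot_alg s L1 br1 R) \<Longrightarrow> X' \<in> car (quot_alg s L1 br1 R) \<Longrightarrow>
          (\<And>Y. Y \<in> car (quot_alg s L2 br2 R) \<Longrightarrow> \<pi> X Y = \<pi> X' Y) \<Longrightarrow> X = X'"
    and pi_nondegenerate: "\<And>Y. Y \<in> car (quot_alg s L2 br2 R) \<Longrightarrow>
          (\<And>X. X \<in> car (quot_alg s L1 br1 R) \<Longrightarrow> \<pi> X Y = 0) \<Longrightarrow> Y = zer (quot_alg s L2 br2 R)"

definition psi' :: "'a::ab_group_add set \<Rightarrow> ('a set \<Rightarrow> 'a set \<Rightarrow> 'a) \<Rightarrow> 'a \<Rightarrow> 'a \<Rightarrow> 'a" where
  "psi' R \<pi> x y = \<pi> (x +o R) (y +o R)"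

definition M_prod ::
  "('a::ab_group_add \<Rightarrow> 'a \<Rightarrow> 'a) \<Rightarrow> ('a \<Rightarrow> 'a \<Rightarrow> 'a) \<Rightarrow> 'a set \<Rightarrow> ('a \<Rightarrow> 'a \<Rightarrow> 'a) \<Rightarrow>
   ('a set \<Rightarrow> 'a set \<Rightarrow> 'a) \<Rightarrow> 'a \<times> 'a \<Rightarrow> 'a \<times> 'a \<Rightarrow> 'a \<times> 'a" where
  "M_prod br1 br2 R \<alpha> \<pi> = (\<lambda>(x1, y1) (x2, y2).
     (br1 x1 x2, \<alpha> x1 y2 - \<alpha> x2 y1 + br2 y1 y2 + psi' R \<pi> x2 y1))"

definition M_tilde ::
  "(complex \<Rightarrow> 'a::ab_group_add \<Rightarrow> 'a) \<Rightarrow> 'a set \<Rightarrow> ('a \<Rightarrow> 'a \<Rightarrow> 'a) \<Rightarrow> 'a set \<Rightarrow> ('a \<Rightarrow> 'a \<Rightarrow> 'a) \<Rightarrow>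
   'a set \<Rightarrow> ('a \<Rightarrow> 'a \<Rightarrow> 'a) \<Rightarrow> ('a set \<Rightarrow> 'a set \<Rightarrow> 'a) \<Rightarrow> ('a \<times> 'a) set calg" where
  "M_tilde s L1 br1 L2 br2 R \<alpha> \<pi> =
     quot_alg (module_prod.scale s s) (L1 \<times> L2) (M_prod br1 br2 R \<alpha> \<pi>) {(a, - a) | a. a \<in> R}"

end

theory Submission
  imports Defs
begin

text \<open>
  The product of a symmetric Leibniz algebra of rank \<open>1\<close> satisfies \<open>[xy] + [yx] = f(x,y) c\<close> with \<open>c\<close>
  a central vector spanning the Leibniz kernel and \<open>f\<close> a symmetric bilinear form. Comparing the left
  and the right Leibniz identity shows that \<open>[MM]\<close> lies in the radical \<open>K\<close> of \<open>f\<close>, so every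
  subspace containing \<open>K\<close> is an ideal. Over the complex numbers, \<open>M/K\<close> is the sum of two totally
  isotropic subspaces \<open>A/K\<close>, \<open>B/K\<close> in duality and of an at most one-dimensional space. On \<open>A\<close> and \<open>B\<close>
  the product is antisymmetric, hence a Lie bracket, and \<open>A + B\<close> is the algebra built from
  \<open>L1 = A\<close>, \<open>L2 = B\<close>, \<open>R = K\<close>, \<open>\<alpha>(x)(y) = [xy]\<close> and \<open>\<pi>(x)(y) = [xy] + [yx]\<close>.
\<close>

section \<open>Isotropic decompositions of symmetric forms\<close>

locale symmetric_form = vector_space s
  for s :: "complex \<Rightarrow> 'a::ab_group_add \<Rightarrow> 'a" +
  fixes V :: "'a set" and f :: "'a \<Rightarrow> 'a \<Rightarrow> complex"
  assumes V_subspace: "subspace V"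
    and f_add: "\<And>x y z. x \<in> V \<Longrightarrow> y \<in> V \<Longrightarrow> z \<in> V \<Longrightarrow> f (x + y) z = f x z + f y z"
    and f_scale: "\<And>t x y. x \<in> V \<Longrightarrow> y \<in> V \<Longrightarrow> f (s t x) y = t * f x y"
    and f_sym: "\<And>x y. x \<in> V \<Longrightarrow> y \<in> V \<Longrightarrow> f x y = f y x"
begin

definition radical :: "'a set" where
  "radical = {x \<in> V. \<forall>y\<in>V. f x y = 0}"

lemmas V_add = subspace_add[OF V_subspace]
lemmas V_diff = subspace_diff[OF V_subspace]
lemmas V_scale = subspace_scale[OF V_subspace]
lemmas V_zero = subspace_0[OF V_subspace]

lemma f_add_right: "x \<in> V \<Longrightarrow> y \<in> V \<Longrightarrow> z \<in> V \<Longrightarrow> f z (x + y) = f z x + f z y"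
  using f_add[of x y z] f_sym V_add by metis

lemma f_scale_right: "x \<in> V \<Longrightarrow> y \<in> V \<Longrightarrow> f y (s t x) = t * f y x"
  using f_scale[of x y t] f_sym V_scale by metis

lemma f_diff: "x \<in> V \<Longrightarrow> y \<in> V \<Longrightarrow> z \<in> V \<Longrightarrow> f (x - y) z = f x z - f y z"
  using f_add[of "x - y" y z] V_diff by simp

lemma f_diff_right: "x \<in> V \<Longrightarrow> y \<in> V \<Longrightarrow> z \<in> V \<Longrightarrow> f z (x - y) = f z x - f z y"
  using f_add_right[of "x - y" y z] V_diff by simp

lemma f_zero: "x \<in> V \<Longrightarrow> f 0 x = 0"
  using f_add[of 0 0 x] V_zero by simp

lemmas f_simps = f_add f_add_right f_scale f_scale_right f_diff f_diff_right
  V_add V_diff V_scale V_zero f_zero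

lemma radicalD: "x \<in> radical \<Longrightarrow> x \<in> V" "x \<in> radical \<Longrightarrow> y \<in> V \<Longrightarrow> f x y = 0"
  "x \<in> radical \<Longrightarrow> y \<in> V \<Longrightarrow> f y x = 0"
  using f_sym by (auto simp: radical_def)

lemma subspace_radical: "subspace radical"
  unfolding subspace_def by (auto simp: radical_def f_simps)

text \<open>A Witt decomposition of \<open>V\<close> modulo the radical, lifted to \<open>V\<close>.
  Nothing is asked of \<open>e\<close> beyond spanning: it may be zero or lie in
  \<open>A + B\<close>, so even and odd rank of \<open>f\<close> are treated together.\<close>

definition isotropic_pair :: "'a set \<Rightarrow> 'a set \<Rightarrow> 'a \<Rightarrow> bool" where
  "isotropic_pair A B e \<longleftrightarrow>
     subspace A \<and> subspace B \<and> A \<subseteq> V \<and> B \<subseteq> V \<and> radical \<subseteq> A \<and> radical \<subseteq> B \<and>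
     (\<forall>x\<in>A. \<forall>y\<in>A. f x y = 0) \<and> (\<forall>x\<in>B. \<forall>y\<in>B. f x y = 0) \<and>
     (\<forall>x\<in>A. (\<forall>y\<in>B. f x y = 0) \<longrightarrow> x \<in> radical) \<and>
     (\<forall>y\<in>B. (\<forall>x\<in>A. f x y = 0) \<longrightarrow> y \<in> radical) \<and>
     (\<forall>v\<in>V. \<exists>a\<in>A. \<exists>b\<in>B. \<exists>t. v = a + b + s t e)"

lemma isotropic_pairD:
  assumes "isotropic_pair A B e"
  shows "subspace A" "A \<subseteq> V" "radical \<subseteq> A" "\<And>x y. x \<in> A \<Longrightarrow> y \<in> A \<Longrightarrow> f x y = 0"
    "\<And>x. x \<in> A \<Longrightarrow> (\<And>y. y \<in> B \<Longrightarrow> f x y = 0) \<Longrightarrow> x \<in> radical"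
    "subspace B" "B \<subseteq> V" "radical \<subseteq> B" "\<And>x y. x \<in> B \<Longrightarrow> y \<in> B \<Longrightarrow> f x y = 0"
    "\<And>y. y \<in> B \<Longrightarrow> (\<And>x. x \<in> A \<Longrightarrow> f x y = 0) \<Longrightarrow> y \<in> radical"
    "\<And>v. v \<in> V \<Longrightarrow> \<exists>a\<in>A. \<exists>b\<in>B. \<exists>t. v = a + b + s t e"
  using assms unfolding isotropic_pair_def by simp_all

text \<open>Over the complex numbers a form in two variables always has an isotropic vector, so
  without isotropic vectors outside the radical \<open>V\<close> has dimension at most one modulo
  \<open>radical\<close>.\<close>

lemma isotropic_pair_anisotropic:
  assumes aniso: "\<And>x. x \<in> V \<Longrightarrow> f x x = 0 \<Longrightarrow> x \<in> radical"
  shows "\<exists>e. isotropic_pair radical radical e"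
proof -
  have "\<exists>e. \<forall>v\<in>V. \<exists>t. v - s t e \<in> radical"
  proof (cases "V \<subseteq> radical")
    case True
    \<comment> \<open>Any \<open>e\<close> serves, with \<open>t = 0\<close>.\<close>
    then show ?thesis by (metis diff_zero scale_zero_left subsetD)
  next
    case False
    then obtain u where u: "u \<in> V" "u \<notin> radical" by auto
    then have fu: "f u u \<noteq> 0" using aniso by blast
    have "\<exists>t. v - s t u \<in> radical" if v: "v \<in> V" for v
    proof -
      \<comment> \<open>\<open>?t\<close> is a root of the quadratic polynomial
        \<open>f (v - s t u) (v - s t u)\<close> in \<open>t\<close>, by the usual formula with the
        reduced discriminant under the root.\<close>
      let ?d = "csqrt ((f u v)\<^sup>2 - f u u * f v v)"
      let ?t = "(f u v + ?d) / f u u"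
      have "f u u * ?t = f u v + ?d" using fu by simp
      then have "(f u u * ?t - f u v)\<^sup>2 = (f u v)\<^sup>2 - f u u * f v v" by simp
      then have "f u u * (f v v - 2 * ?t * f u v + ?t * ?t * f u u) = 0"
        by (simp only: power2_eq_square) algebra
      then have q: "f v v - 2 * ?t * f u v + ?t * ?t * f u u = 0" using fu by (simp only: mult_eq_0_iff) simp
      have "f (v - s t u) (v - s t u) = f v v - 2 * t * f u v + t * t * f u u" for t
        using u v f_sym[of u v] by (simp add: f_simps algebra_simps)
      then show ?thesis using aniso q u v V_diff V_scale by metis
    qed
    then show ?thesis by blast
  qed
  then obtain e where e: "\<forall>v\<in>V. \<exists>t. v - s t e \<in> radical" by blast
  have "\<exists>a\<in>radical. \<exists>b\<in>radical. \<exists>t. v = a + b + s t e" if v: "v \<in> V" for v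
  proof -
    obtain t where "v - s t e \<in> radical" using e v by blast
    moreover have "v = (v - s t e) + 0 + s t e" by simp
    ultimately show ?thesis using subspace_0[OF subspace_radical] by blast
  qed
  then show ?thesis unfolding isotropic_pair_def
    using subspace_radical radicalD by (intro exI[of _ e]) blast
qed

end

text \<open>Scale some vector to \<open>w\<close> with \<open>f x w = 1\<close>. Subtracting
  \<open>t\<close> times the isotropic \<open>x\<close> changes \<open>f w w\<close> by
  \<open>- 2 * t\<close> and leaves \<open>f x w\<close> alone, which dictates
  \<open>t = f w w / 2\<close>.\<close>

lemma (in symmetric_form) hyperbolic_partner:
  assumes x: "x \<in> V" "x \<notin> radical" "f x x = 0"
  obtains y where "y \<in> V" "f y y = 0" "f x y = 1"
proof -
  obtain z where z: "z \<in> V" "f x z \<noteq> 0" using x by (auto simp: radical_def)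
  define w where "w = s (1 / f x z) z"
  have w: "w \<in> V" "f x w = 1" using x z by (auto simp: w_def f_simps)
  define y where "y = w - s (f w w / 2) x"
  show thesis
  proof (rule that)
    show "y \<in> V" using x w by (simp add: y_def f_simps)
    show "f y y = 0" using x w f_sym[of x w] by (simp add: y_def f_simps)
    show "f x y = 1" using x w by (simp add: y_def f_simps)
  qed
qed

lemma (in vector_space) subspace_add_line:
  assumes "subspace A"
  shows "subspace {a + scale t x | a t. a \<in> A}"
proof -
  have "{a + scale t x | a t. a \<in> A} = {a + b | a b. a \<in> A \<and> b \<in> span {x}}"
    by (auto simp: span_singleton)
  then show ?thesis using subspace_sums[OF assms subspace_span] by simp
qed

text \<open>
  Induction on a bound for the size of independent subsets of \<open>V\<close>: split off a hyperbolic plane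
  spanned by \<open>x\<close>, \<open>y\<close>; its orthogonal complement has the same radical.
\<close>

lemma isotropic_pair_exists_bounded:
  assumes "symmetric_form s V f"
    and "\<And>T. T \<subseteq> V \<Longrightarrow> \<not> module.dependent s T \<Longrightarrow> finite T \<and> card T < n"
  shows "\<exists>A B e. symmetric_form.isotropic_pair s V f A B e"
  using assms
proof (induction n arbitrary: V)
  case 0
  interpret symmetric_form s V f by fact
  \<comment> \<open>The bound is strict, so already the empty set contradicts it.\<close>
  show ?case using "0.prems"(2)[of "{}"] by (simp add: independent_empty)
next
  case (Suc n)
  interpret symmetric_form s V f by fact
  show ?case
  proof (cases "\<forall>x\<in>V. f x x = 0 \<longrightarrow> x \<in> radical")
    case True
    then show ?thesis using isotropic_pair_anisotropic by blast
  next
    case False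
    then obtain x where x: "x \<in> V" "f x x = 0" "x \<notin> radical" by blast
    then obtain y where y: "y \<in> V" "f y y = 0" "f x y = 1" using hyperbolic_partner by metis
    have yx: "f y x = 1" using f_sym x y by simp
    define W where "W = {v \<in> V. f v x = 0 \<and> f v y = 0}"
    have WV: "W \<subseteq> V" by (auto simp: W_def)
    have orth: "f w x = 0" "f x w = 0" "f w y = 0" "f y w = 0" if "w \<in> W" for w
      using that x y f_sym by (auto simp: W_def)
    have subW: "subspace W"
      unfolding subspace_def using x y by (auto simp: W_def f_simps)
    interpret W: symmetric_form s W f
      using subW subsetD[OF WV] f_add f_scale f_sym by unfold_locales simp_all
    \<comment> \<open>Projection along the hyperbolic plane: as \<open>x\<close> and
      \<open>y\<close> are isotropic and dual, the coefficient of each is the pairing with the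
      other.\<close>
    have decomp: "v - s (f v y) x - s (f v x) y \<in> W" if "v \<in> V" for v
      using that x y yx by (auto simp: W_def f_simps)
    have rad: "W.radical = radical"
    proof
      show "W.radical \<subseteq> radical"
      proof
        fix w assume w: "w \<in> W.radical"
        then have wW: "w \<in> W" by (rule W.radicalD)
        have "f w v = 0" if v: "v \<in> V" for v
        proof -
          let ?u = "v - s (f v y) x - s (f v x) y"
          have "f w ?u = 0" using W.radicalD(2)[OF w] decomp[OF v] by blast
          moreover have "f w ?u = f w v"
            using wW WV v x y orth[OF wW] by (auto simp: f_simps subset_iff)
          ultimately show ?thesis by simp
        qed
        then show "w \<in> radical" using wW WV by (auto simp: radical_def)
      qed
      show "radical \<subseteq> W.radical"
        unfolding radical_def W.radical_def using x y by (auto simp: W_def)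
    qed
    \<comment> \<open>The bound drops by one: \<open>x\<close> lies outside \<open>W\<close> because
      \<open>f x y = 1\<close>, so it extends any independent subset of \<open>W\<close> to a larger
      one of \<open>V\<close>.\<close>
    have "finite T \<and> card T < n" if T: "T \<subseteq> W" "independent T" for T
    proof -
      have "x \<notin> W" using y by (simp add: W_def)
      then have "x \<notin> span T" using span_minimal[OF T(1) subW] by blast
      then have "independent (insert x T)" "x \<notin> T"
        using T(2) independent_insertI span_base by blast+
      moreover have "insert x T \<subseteq> V" using T(1) WV x(1) by blast
      ultimately show ?thesis using Suc.prems(2)[of "insert x T"] by auto
    qed
    then obtain A B e where W_pair: "W.isotropic_pair A B e"
      using Suc.IH[OF W.symmetric_form_axioms] by blast
    note A = W.isotropic_pairD(1-5)[OF W_pair, unfolded rad]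
    note B = W.isotropic_pairD(6-10)[OF W_pair, unfolded rad]
    note AB = W.isotropic_pairD(11)[OF W_pair]
    \<comment> \<open>The hyperbolic plane is shared out, \<open>x\<close> to one side and
      \<open>y\<close> to the other; \<open>e\<close> is kept.\<close>
    define A' where "A' = {a + s t x | a t. a \<in> A}"
    define B' where "B' = {b + s t y | b t. b \<in> B}"
    have inA: "a \<in> A'" if "a \<in> A" for a
      unfolding A'_def using that by (intro CollectI exI[of _ a] exI[of _ 0]) simp
    have inB: "b \<in> B'" if "b \<in> B" for b
      unfolding B'_def using that by (intro CollectI exI[of _ b] exI[of _ 0]) simp
    have xA: "x \<in> A'"
      unfolding A'_def using subspace_0[OF A(1)] by (intro CollectI exI[of _ 0] exI[of _ 1]) simp
    have yB: "y \<in> B'"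
      unfolding B'_def using subspace_0[OF B(1)] by (intro CollectI exI[of _ 0] exI[of _ 1]) simp
    have AV: "a \<in> V" if "a \<in> A" for a using that A WV by blast
    have BV: "b \<in> V" if "b \<in> B" for b using that B WV by blast
    have Ao: "f a x = 0" "f x a = 0" "f a y = 0" "f y a = 0" if "a \<in> A" for a
      using orth that A(2) by blast+
    have Bo: "f a x = 0" "f x a = 0" "f a y = 0" "f y a = 0" if "a \<in> B" for a
      using orth that B(2) by blast+
    have "isotropic_pair A' B' e"
      unfolding isotropic_pair_def
    proof (intro conjI ballI impI)
      show "subspace A'" "subspace B'"
        unfolding A'_def B'_def using subspace_add_line A B by auto
      show "A' \<subseteq> V" "B' \<subseteq> V"
        unfolding A'_def B'_def using AV BV x y by (auto simp: f_simps)
      show "radical \<subseteq> A'" "radical \<subseteq> B'" using A(3) B(3) inA inB by auto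
    next
      fix u v assume "u \<in> A'" "v \<in> A'"
      then show "f u v = 0"
        unfolding A'_def using AV Ao A(4) x by (auto simp: f_simps)
    next
      fix u v assume "u \<in> B'" "v \<in> B'"
      then show "f u v = 0"
        unfolding B'_def using BV Bo B(4) y by (auto simp: f_simps)
    next
      fix u assume u: "u \<in> A'" and z: "\<forall>v\<in>B'. f u v = 0"
      then obtain a t where a: "u = a + s t x" "a \<in> A" unfolding A'_def by blast
      \<comment> \<open>Pairing with \<open>y\<close> reads off the coefficient of \<open>x\<close>,
        which reduces the duality to the one between \<open>A\<close> and \<open>B\<close>.\<close>
      have "f u y = t" using a AV Ao x y by (simp add: f_simps)
      then have "t = 0" using z yB by simp
      then have ua: "u = a" using a by simp
      then show "u \<in> radical" using A(5)[of a] a z inB by blast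
    next
      fix u assume u: "u \<in> B'" and z: "\<forall>v\<in>A'. f v u = 0"
      then obtain b t where b: "u = b + s t y" "b \<in> B" unfolding B'_def by blast
      have "f x u = t" using b BV Bo x y by (simp add: f_simps)
      then have "t = 0" using z xA by simp
      then have ub: "u = b" using b by simp
      then show "u \<in> radical" using B(5)[of b] b z inA by blast
    next
      fix v assume v: "v \<in> V"
      obtain a b t where ab: "a \<in> A" "b \<in> B" "v - s (f v y) x - s (f v x) y = a + b + s t e"
        using AB[OF decomp[OF v]] by blast
      then have "v = (a + s (f v y) x) + (b + s (f v x) y) + s t e"
        by (simp add: algebra_simps)
      moreover have "a + s (f v y) x \<in> A'" "b + s (f v x) y \<in> B'"
        unfolding A'_def B'_def using ab by blast+
      ultimately show "\<exists>a\<in>A'. \<exists>b\<in>B'. \<exists>t. v = a + b + s t e" by blast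
    qed
    then show ?thesis by blast
  qed
qed

lemma (in symmetric_form) isotropic_pair_exists:
  assumes "finite G" "V = span G"
  shows "\<exists>A B e. isotropic_pair A B e"
  \<comment> \<open>Independent sets have at most \<open>card G\<close> elements, and the bound
    required is strict.\<close>
  by (rule isotropic_pair_exists_bounded[where n = "Suc (card G)"])
    (use assms independent_span_bound[OF assms(1)] symmetric_form_axioms
      in \<open>auto simp: less_Suc_eq_le\<close>)

text \<open>A basis of \<open>U\<close> is independent inside \<open>span G\<close>, hence finite.
  It supplies finite generation of the Lie algebras and the basis for counting codimension.\<close>

lemma (in vector_space) subspace_finite_span:
  assumes "finite G" "subspace U" "U \<subseteq> span G"
  obtains T where "finite T" "U = span T" "card T = dim U"
proof -
  obtain T where T: "T \<subseteq> U" "independent T" "U \<subseteq> span T" "card T = dim U"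
    using basis_exists by blast
  then have "finite T" using independent_span_bound[OF assms(1) T(2)] assms by blast
  moreover have "U = span T" using T assms(2) span_minimal by blast
  ultimately show thesis using that T by blast
qed

section \<open>Cosets\<close>

lemma (in vector_space) coset_eq_iff:
  assumes "subspace R"
  shows "u +o R = v +o R \<longleftrightarrow> u - v \<in> R"
proof
  assume "u +o R = v +o R"
  then have "u \<in> v +o R" using subspace_0[OF assms] by (force simp: elt_set_plus_def)
  then show "u - v \<in> R" by (auto simp: elt_set_plus_def)
next
  assume d: "u - v \<in> R"
  show "u +o R = v +o R"
  proof (rule set_eqI)
    fix z
    have "z \<in> u +o R \<longleftrightarrow> z - u \<in> R" for u
      by (auto simp: elt_set_plus_def) (metis add_diff_cancel_left' diff_add_cancel add.commute)
    moreover have "z - u \<in> R \<longleftrightarrow> z - v \<in> R"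
      using subspace_add[OF assms d, of "z - u"] subspace_diff[OF assms _ d, of "z - v"] by auto
    ultimately show "z \<in> u +o R \<longleftrightarrow> z \<in> v +o R" by blast
  qed
qed

text \<open>Scaling and product in \<open>quot_alg\<close> have the shape \<open>S + R\<close>; if
  \<open>S\<close> is a nonempty part of one coset, adding \<open>R\<close> fills up that
  coset.\<close>

lemma (in vector_space) set_plus_subspace:
  assumes "subspace R" "S \<noteq> {}" "\<And>x. x \<in> S \<Longrightarrow> x - u \<in> R"
  shows "S + R = u +o R"
proof
  show "S + R \<subseteq> u +o R"
  proof
    fix z assume "z \<in> S + R"
    then obtain x r where "z = x + r" "x \<in> S" "r \<in> R" by (auto simp: set_plus_def)
    then have "z = u + (x - u + r)" "x - u + r \<in> R"
      using assms subspace_add by auto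
    then show "z \<in> u +o R" unfolding elt_set_plus_def by blast
  qed
  obtain x where x: "x \<in> S" using assms by blast
  have "u +o R = x +o R" using coset_eq_iff[OF assms(1)] assms(3)[OF x] by metis
  also have "\<dots> \<subseteq> S + R" using x by (auto simp: elt_set_plus_def set_plus_def)
  finally show "u +o R \<subseteq> S + R" .
qed

lemma (in vector_space) coset_self: "subspace R \<Longrightarrow> u \<in> u +o R"
  using subspace_0 by (force simp: elt_set_plus_def)

lemma (in vector_space) coset_add:
  assumes "subspace R"
  shows "(u +o R) + (v +o R) = (u + v) +o R"
proof -
  have "R + R = R" using set_plus_subspace[OF assms, of R 0] subspace_0[OF assms] by auto
  then show ?thesis using set_plus_rearrange[of u R v R] by simp
qed

lemma coset_scale:
  assumes "vector_space s" "module.subspace s R"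
  shows "s c ` (u +o R) + R = s c u +o R"
proof -
  interpret vector_space s by fact
  show ?thesis
    by (rule set_plus_subspace)
      (use assms coset_self in \<open>auto simp: elt_set_plus_def scale_right_distrib subspace_scale\<close>)
qed

section \<open>Splitting a symmetric Leibniz algebra of rank one\<close>

text \<open>The left Leibniz identity is kept as \<open>br_leibniz\<close>; consequences of the
  right one are recorded in \<open>f_br\<close> and \<open>c_central\<close>.\<close>

locale split_symmetric_leibniz = symmetric_form s V f
  for s :: "complex \<Rightarrow> 'a::ab_group_add \<Rightarrow> 'a" and V :: "'a set" and f :: "'a \<Rightarrow> 'a \<Rightarrow> complex" +
  fixes br :: "'a \<Rightarrow> 'a \<Rightarrow> 'a" and G :: "'a set" and c :: 'a and A B :: "'a set" and e :: 'a
  assumes V_span: "finite G" "V = span G"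
    and br_closed: "\<And>x y. x \<in> V \<Longrightarrow> y \<in> V \<Longrightarrow> br x y \<in> V"
    and br_add_left: "\<And>x y z. x \<in> V \<Longrightarrow> y \<in> V \<Longrightarrow> z \<in> V \<Longrightarrow> br (x + y) z = br x z + br y z"
    and br_add_right: "\<And>x y z. x \<in> V \<Longrightarrow> y \<in> V \<Longrightarrow> z \<in> V \<Longrightarrow> br x (y + z) = br x y + br x z"
    and br_scale_left: "\<And>t x y. x \<in> V \<Longrightarrow> y \<in> V \<Longrightarrow> br (s t x) y = s t (br x y)"
    and br_scale_right: "\<And>t x y. x \<in> V \<Longrightarrow> y \<in> V \<Longrightarrow> br x (s t y) = s t (br x y)"
    and br_leibniz: "\<And>x y z. x \<in> V \<Longrightarrow> y \<in> V \<Longrightarrow> z \<in> V \<Longrightarrow>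
          br x (br y z) = br (br x y) z + br y (br x z)"
    and br_sym: "\<And>x y. x \<in> V \<Longrightarrow> y \<in> V \<Longrightarrow> br x y + br y x = s (f x y) c"
    and f_br: "\<And>x y z. x \<in> V \<Longrightarrow> y \<in> V \<Longrightarrow> z \<in> V \<Longrightarrow> f x (br y z) = 0"
    and c_nonzero: "c \<noteq> 0"
    and c_radical: "c \<in> radical"
    and c_central: "\<And>x. x \<in> V \<Longrightarrow> br c x = 0" "\<And>x. x \<in> V \<Longrightarrow> br x c = 0"
    and pair: "isotropic_pair A B e"
begin

lemmas A_facts = isotropic_pairD(1-5)[OF pair]
lemmas B_facts = isotropic_pairD(6-10)[OF pair]
lemmas V_decomp = isotropic_pairD(11)[OF pair]

text \<open>As an element of \<open>B\<close>, \<open>x\<close> annihilates \<open>B\<close>; by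
  duality such an element of \<open>A\<close> is in the radical.\<close>

lemma A_inter_B: "x \<in> A \<Longrightarrow> x \<in> B \<Longrightarrow> x \<in> radical"
  using A_facts B_facts by blast

lemma br_radical: "x \<in> V \<Longrightarrow> y \<in> V \<Longrightarrow> br x y \<in> radical"
  using f_br br_closed f_sym unfolding radical_def by auto

lemma ideal_if_radical_subset:
  assumes "subspace U" "radical \<subseteq> U" "U \<subseteq> W" "W \<subseteq> V"
  shows "ideal_on s W br U"
  using assms br_radical unfolding ideal_on_def by blast

text \<open>Where \<open>f\<close> vanishes, \<open>br_sym\<close> is antisymmetry, and antisymmetry
  turns the left Leibniz identity into the Jacobi identity.\<close>

lemma lie_algebra_if_isotropic:
  assumes U: "subspace U" "U \<subseteq> V" "radical \<subseteq> U" and iso: "\<And>x y. x \<in> U \<Longrightarrow> y \<in> U \<Longrightarrow> f x y = 0"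
  shows "lie_algebra_on s U br"
  unfolding lie_algebra_on_def
proof (intro conjI ballI)
  have anti: "br x y = - br y x" if "x \<in> U" "y \<in> U" for x y
    using br_sym[of x y] iso[of x y] U that by (auto simp: eq_neg_iff_add_eq_0)
  have closed: "br x y \<in> U" if "x \<in> U" "y \<in> U" for x y
    using br_radical U that by blast
  have "\<exists>T. finite T \<and> U = span T"
    using subspace_finite_span[OF V_span(1) U(1)] U V_span by metis
  then show "algebra_on s U br"
    unfolding algebra_on_def using U(1) closed vector_space_axioms U(2) br_add_left br_add_right
      br_scale_left br_scale_right by (simp add: subset_iff)
  show "br x x = 0" if "x \<in> U" for x
  proof -
    \<comment> \<open>The additive group alone does not exclude 2-torsion, so the factor 2 is
      cancelled as a scalar.\<close>
    have "s 2 (br x x) = br x x + br x x"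
      using scale_left_distrib[of 1 1 "br x x"] by simp
    also have "\<dots> = 0" using anti[OF that that] by (metis add.right_inverse)
    finally show ?thesis by simp
  qed
  show "br x (br y z) + br y (br z x) + br z (br x y) = 0"
    if xyz: "x \<in> U" "y \<in> U" "z \<in> U" for x y z
  proof -
    have "br x (br y z) = br (br x y) z + br y (br x z)" using br_leibniz xyz U by blast
    moreover have "br (br x y) z = - br z (br x y)" using anti closed xyz by blast
    moreover have "br y (br x z) = - br y (br z x)"
      using anti[of x z] br_scale_right[of y "br z x" "-1"] br_closed xyz U by auto
    ultimately show ?thesis by simp
  qed
qed

text \<open>This is the left Leibniz identity. The element \<open>x\<close> ranges over all of
  \<open>V\<close>, so that \<open>A\<close> can act on \<open>B\<close>.\<close>

lemma br_derivation:
  assumes "subspace U" "U \<subseteq> V" "radical \<subseteq> U" "x \<in> V"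
  shows "br x \<in> derivations s U br"
  unfolding derivations_def
proof (intro CollectI conjI ballI allI)
  show "br x y \<in> U" if "y \<in> U" for y using br_radical assms that by blast
  show "br x (y + z) = br x y + br x z" if "y \<in> U" "z \<in> U" for y z
    using br_add_right assms that by blast
  show "br x (s t y) = s t (br x y)" if "y \<in> U" for t y
    using br_scale_right assms that by blast
  show "br x (br y z) = br (br x y) z + br y (br x z)" if "y \<in> U" "z \<in> U" for y z
    using br_leibniz assms that by blast
qed

section \<open>The data attached to an isotropic pair\<close>

definition pairing :: "'a set \<Rightarrow> 'a set \<Rightarrow> 'a" where
  "pairing X Y = s (f (SOME u. u \<in> X) (SOME v. v \<in> Y)) c"

text \<open>The representatives chosen by \<open>SOME\<close> differ from \<open>u\<close> and
  \<open>v\<close> by radical vectors, which \<open>f\<close> does not see. By \<open>br_sym\<close>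
  the value is the symmetrised product \<open>br u v + br v u\<close>.\<close>

lemma pairing_coset:
  assumes "u \<in> V" "v \<in> V"
  shows "pairing (u +o radical) (v +o radical) = s (f u v) c"
proof -
  have *: "\<exists>r\<in>radical. (SOME w. w \<in> u +o radical) = u + r" for u
    using someI[of "\<lambda>w. w \<in> u +o radical", OF coset_self[OF subspace_radical]]
    by (auto simp: elt_set_plus_def)
  obtain r r' where r: "r \<in> radical" "r' \<in> radical"
    "(SOME w. w \<in> u +o radical) = u + r" "(SOME w. w \<in> v +o radical) = v + r'"
    using *[of u] *[of v] by blast
  have "f (u + r) (v + r') = f u v"
    using assms r(1,2) radicalD by (simp add: f_simps)
  then show ?thesis by (simp add: pairing_def r)
qed

lemma c_scale_radical: "s t c \<in> radical"
  using c_radical subspace_radical subspace_scale by blast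

lemma c_scale_center:
  assumes "subspace U" "radical \<subseteq> U" "U \<subseteq> V"
  shows "s t c \<in> lie_center U br"
proof -
  have "br (s t c) x = 0" if "x \<in> U" for x
    using that assms br_scale_left[of c x t] c_central radicalD(1)[OF c_radical] by auto
  then show ?thesis unfolding lie_center_def using c_scale_radical assms by blast
qed

lemma car_quot: "X \<in> car (quot_alg s U br radical) \<longleftrightarrow> (\<exists>u\<in>U. X = u +o radical)"
  by (auto simp: quot_alg_def)

lemma leibniz_data: "leibniz_data s A br B br radical br pairing"
proof (intro leibniz_data.intro leibniz_data_axioms.intro)
  have AV: "A \<subseteq> V" and BV: "B \<subseteq> V" using A_facts B_facts by auto
  note VS = vector_space_axioms
  note subR = subspace_radical
  show "vector_space s" by (fact VS)
  show "lie_algebra_on s A br" using lie_algebra_if_isotropic A_facts AV by blast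
  show "lie_algebra_on s B br" using lie_algebra_if_isotropic B_facts BV by blast
  show "ideal_on s A br radical" "ideal_on s B br radical"
    using ideal_if_radical_subset[OF subR] A_facts B_facts AV BV by auto
  show "abelian_alg (quot_alg s B br radical)"
    unfolding abelian_alg_def
  proof (intro ballI)
    fix X Y assume "X \<in> car (quot_alg s B br radical)" "Y \<in> car (quot_alg s B br radical)"
    then obtain u v where uv: "u \<in> V" "X = u +o radical" "v \<in> V" "Y = v +o radical"
      using BV by (auto simp: car_quot)
    have XV: "X \<subseteq> V" "Y \<subseteq> V" using uv radicalD(1) V_add by (auto simp: elt_set_plus_def)
    \<comment> \<open>This makes the set of products nonempty; it lies in the radical, so its coset
      is the zero coset.\<close>
    have "u \<in> X" "v \<in> Y" using uv coset_self[OF subR] by auto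
    then have "{br x y | x y. x \<in> X \<and> y \<in> Y} + radical = 0 +o radical"
      using XV br_radical by (intro set_plus_subspace subR) auto
    then show "mul (quot_alg s B br radical) X Y = zer (quot_alg s B br radical)"
      by (simp add: quot_alg_def)
  qed
  show "br x \<in> derivations s B br" if "x \<in> A" for x
    using br_derivation B_facts BV AV that by blast
  show "br (x + x') y = br x y + br x' y" if "x \<in> A" "x' \<in> A" "y \<in> B" for x x' y
    using br_add_left AV BV that by blast
  show "br (s t x) y = s t (br x y)" if "x \<in> A" "y \<in> B" for t x y
    using br_scale_left AV BV that by blast
  show "br (br x x') y = br x (br x' y) - br x' (br x y)" if "x \<in> A" "x' \<in> A" "y \<in> B" for x x' y
    using br_leibniz[of x x' y] AV BV that by (simp add: subset_iff)
  show "pairing X \<in> linear_maps s (quot_alg s B br radical)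
          (radical \<inter> lie_center A br \<inter> lie_center B br)"
    if X: "X \<in> car (quot_alg s A br radical)" for X
  proof -
    obtain u where u: "u \<in> V" "X = u +o radical" using AV X by (auto simp: car_quot)
    have val: "pairing X (v +o radical) = s (f u v) c" if "v \<in> B" for v
      using u that BV pairing_coset by auto
    have "pairing X (v +o radical + (w +o radical)) =
            pairing X (v +o radical) + pairing X (w +o radical)" if "v \<in> B" "w \<in> B" for v w
      using that u BV val coset_add[OF subR] subspace_add[OF B_facts(1)]
      by (simp add: f_simps scale_left_distrib subset_iff)
    moreover have "pairing X (s t ` (v +o radical) + radical) = s t (pairing X (v +o radical))"
      if "v \<in> B" for t v
      using that u BV val coset_scale[OF VS subR] subspace_scale[OF B_facts(1)]
      by (simp add: f_simps subset_iff)
    ultimately show ?thesis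
      unfolding linear_maps_def
      using val c_scale_radical c_scale_center A_facts(1,3) B_facts(1,3) AV BV
      by (auto simp: quot_alg_def)
  qed
  show "pairing (add (quot_alg s A br radical) X X') Y = pairing X Y + pairing X' Y"
    if "X \<in> car (quot_alg s A br radical)" "X' \<in> car (quot_alg s A br radical)"
      "Y \<in> car (quot_alg s B br radical)" for X X' Y
    using that subsetD[OF A_facts(2)] subsetD[OF B_facts(2)]
    by (auto simp: quot_alg_def coset_add[OF subR] pairing_coset f_simps scale_left_distrib)
  show "pairing (scl (quot_alg s A br radical) t X) Y = s t (pairing X Y)"
    if "X \<in> car (quot_alg s A br radical)" "Y \<in> car (quot_alg s B br radical)" for t X Y
    using that subsetD[OF A_facts(2)] subsetD[OF B_facts(2)]
    by (auto simp: quot_alg_def coset_scale[OF VS subR] pairing_coset f_simps)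
  show "pairing (br x u +o radical) (v +o radical) = - pairing (u +o radical) (br x v +o radical)"
    if "x \<in> A" "u \<in> A" "v \<in> B" for x u v
  proof -
    have V: "x \<in> V" "u \<in> V" "v \<in> V" using that AV BV by auto
    \<comment> \<open>Equivariance is trivial: products are radical, so both sides vanish.\<close>
    then have "f (br x u) v = 0" "f u (br x v) = 0" using f_br f_sym br_closed by metis+
    then show ?thesis using V br_closed by (simp add: pairing_coset)
  qed
  show "X = X'"
    if X: "X \<in> car (quot_alg s A br radical)" and X': "X' \<in> car (quot_alg s A br radical)"
      and eq: "\<And>Y. Y \<in> car (quot_alg s B br radical) \<Longrightarrow> pairing X Y = pairing X' Y" for X X'
  proof -
    obtain u u' where u: "u \<in> A" "u' \<in> A" "X = u +o radical" "X' = u' +o radical"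
      using X X' by (auto simp: car_quot)
    have "f (u - u') v = 0" if v: "v \<in> B" for v
    proof -
      have "v +o radical \<in> car (quot_alg s B br radical)" using v by (auto simp: car_quot)
      then have "s (f u v) c = s (f u' v) c"
        using eq[of "v +o radical"] u v AV BV by (simp add: pairing_coset subset_iff)
      then show ?thesis using c_nonzero u v AV BV by (simp add: f_simps subset_iff)
    qed
    then have "u - u' \<in> radical" using A_facts u subspace_diff by blast
    then show ?thesis using u coset_eq_iff[OF subR] by simp
  qed
  show "Y = zer (quot_alg s B br radical)"
    if Y: "Y \<in> car (quot_alg s B br radical)"
      and z: "\<And>X. X \<in> car (quot_alg s A br radical) \<Longrightarrow> pairing X Y = 0" for Y
  proof -
    obtain v where v: "v \<in> B" "Y = v +o radical" using Y by (auto simp: car_quot)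
    have "f u v = 0" if u: "u \<in> A" for u
    proof -
      have "u +o radical \<in> car (quot_alg s A br radical)" using u by (auto simp: car_quot)
      then have "s (f u v) c = 0"
        using z[of "u +o radical"] u v AV BV by (simp add: pairing_coset subset_iff)
      then show ?thesis using c_nonzero by simp
    qed
    \<comment> \<open>The zero of the quotient is \<open>radical\<close> itself, read here as the
      coset of 0.\<close>
    then have "v - 0 \<in> radical" using B_facts v by simp
    then show ?thesis using v coset_eq_iff[OF subR, of v 0] by (simp add: quot_alg_def)
  qed
\<comment> \<open>What is left are the agreement conditions on \<open>radical\<close>, which are
  reflexive since both brackets and the action are \<open>br\<close>.\<close>
qed auto

section \<open>The ideal \<open>A + B\<close> and its codimension\<close>

definition sum_AB :: "'a set" where
  "sum_AB = {a + b | a b. a \<in> A \<and> b \<in> B}"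

lemma subspace_sum_AB: "subspace sum_AB"
  unfolding sum_AB_def by (rule subspace_sums[OF A_facts(1) B_facts(1)])

lemma sum_AB_subset: "sum_AB \<subseteq> V"
  unfolding sum_AB_def using subsetD[OF A_facts(2)] subsetD[OF B_facts(2)] V_add by blast

lemma A_subset_sum_AB: "A \<subseteq> sum_AB"
  unfolding sum_AB_def using subspace_0[OF B_facts(1)] by (force intro: exI[of _ 0])

lemma ideal_sum_AB: "ideal_on s V br sum_AB"
  using ideal_if_radical_subset subspace_sum_AB sum_AB_subset A_subset_sum_AB A_facts(3) by blast

lemma codim_sum_AB: "dim V \<le> dim sum_AB + 1"
proof -
  obtain T where T: "finite T" "sum_AB = span T" "card T = dim sum_AB"
    using subspace_finite_span[OF V_span(1) subspace_sum_AB] sum_AB_subset V_span by metis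
  have "v \<in> span (insert e T)" if v: "v \<in> V" for v
  proof -
    obtain a b t where "a \<in> A" "b \<in> B" "v = a + b + s t e" using V_decomp[OF v] by blast
    then have "v - s t e \<in> span T" using T(2) unfolding sum_AB_def by auto
    then show ?thesis unfolding span_insert by blast
  qed
  then have "dim V \<le> card (insert e T)" using T(1) by (intro dim_le_card) auto
  also have "\<dots> \<le> card T + 1" using T(1) by (simp add: card_insert_if)
  finally show ?thesis using T(3) by simp
qed

section \<open>The isomorphism, sending a sum to its fiber under addition\<close>

definition fiber :: "'a \<Rightarrow> ('a \<times> 'a) set" where
  "fiber z = {(a, b). a \<in> A \<and> b \<in> B \<and> a + b = z}"

definition antidiagonal :: "('a \<times> 'a) set" where
  "antidiagonal = {(a, - a) | a. a \<in> radical}"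

text \<open>Two decompositions of the same sum differ by a vector of both \<open>A\<close> and
  \<open>B\<close>, hence of the radical; so the kernel of addition on \<open>A \<times> B\<close>
  is \<open>antidiagonal\<close>.\<close>

lemma fiber_eq_coset:
  assumes "a \<in> A" "b \<in> B"
  shows "fiber (a + b) = (a, b) +o antidiagonal"
proof
  show "fiber (a + b) \<subseteq> (a, b) +o antidiagonal"
  proof
    fix p assume "p \<in> fiber (a + b)"
    then obtain x y where xy: "p = (x, y)" "x \<in> A" "y \<in> B" "x + y = a + b"
      by (auto simp: fiber_def)
    then have "x - a = b - y" by (simp add: algebra_simps)
    moreover have "x - a \<in> A" "b - y \<in> B"
      using subspace_diff A_facts(1) B_facts(1) xy assms by blast+
    ultimately have "x - a \<in> radical" "- (x - a) = y - b"
      using A_inter_B[of "x - a"] by simp_all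
    then have "(x - a, y - b) \<in> antidiagonal" by (auto simp: antidiagonal_def)
    then show "p \<in> (a, b) +o antidiagonal" using xy(1) by (force simp: elt_set_plus_def)
  qed
  have "a + r \<in> A" "b - r \<in> B" if "r \<in> radical" for r
    using that assms A_facts(3) B_facts(3) subspace_add[OF A_facts(1)] subspace_diff[OF B_facts(1)]
    by blast+
  then show "(a, b) +o antidiagonal \<subseteq> fiber (a + b)"
    by (auto simp: elt_set_plus_def antidiagonal_def fiber_def)
qed

text \<open>The analogue of \<open>set_plus_subspace\<close> for pairs, used to evaluate the
  quotient operations: the coset of each point of a fiber is the whole fiber.\<close>

lemma fiber_absorb:
  assumes "S \<noteq> {}" "S \<subseteq> fiber z"
  shows "S + antidiagonal = fiber z"
proof
  have coset: "p +o antidiagonal = fiber z" if p: "p \<in> S" for p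
  proof -
    obtain a b where "p = (a, b)" "a \<in> A" "b \<in> B" "a + b = z"
      using assms(2) p by (auto simp: fiber_def)
    then show ?thesis using fiber_eq_coset by metis
  qed
  show "S + antidiagonal \<subseteq> fiber z"
    using coset by (force simp: set_plus_def elt_set_plus_def)
  obtain p where "p \<in> S" using assms(1) by blast
  then show "fiber z \<subseteq> S + antidiagonal"
    using coset[of p] by (force simp: set_plus_def elt_set_plus_def)
qed

lemma fiber_nonempty: "z \<in> sum_AB \<Longrightarrow> fiber z \<noteq> {}"
  by (auto simp: sum_AB_def fiber_def)

text \<open>The term \<open>psi'\<close> corrects the sign: \<open>- br x2 y1\<close> plus the
  symmetrised product of \<open>x2\<close> and \<open>y1\<close> is \<open>br y1 x2\<close>, so the
  components add up to the full expansion of \<open>br z w\<close>.\<close>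

lemma M_prod_fiber:
  assumes "p \<in> fiber z" "q \<in> fiber w"
  shows "M_prod br br radical br pairing p q \<in> fiber (br z w)"
proof -
  obtain x1 y1 x2 y2 where p: "p = (x1, y1)" "x1 \<in> A" "y1 \<in> B" "z = x1 + y1"
    and q: "q = (x2, y2)" "x2 \<in> A" "y2 \<in> B" "w = x2 + y2"
    using assms by (auto simp: fiber_def)
  have V: "x1 \<in> V" "y1 \<in> V" "x2 \<in> V" "y2 \<in> V" using p q subsetD[OF A_facts(2)] subsetD[OF B_facts(2)] by auto
  have cross: "s (f x2 y1) c - br x2 y1 = br y1 x2"
    using br_sym[of x2 y1] V by (metis add_diff_cancel_left')
  have "M_prod br br radical br pairing p q =
      (br x1 x2, br x1 y2 - br x2 y1 + br y1 y2 + s (f x2 y1) c)"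
    using V by (simp add: M_prod_def p q psi'_def pairing_coset)
  also have "br x1 y2 - br x2 y1 + br y1 y2 + s (f x2 y1) c = br x1 y2 + br y1 x2 + br y1 y2"
    unfolding cross[symmetric] by (simp add: algebra_simps)
  finally have "M_prod br br radical br pairing p q = (br x1 x2, br x1 y2 + br y1 x2 + br y1 y2)" .
  moreover have "br x1 y2 + br y1 x2 + br y1 y2 \<in> radical" "br x1 x2 \<in> radical"
    using V br_radical subspace_add[OF subspace_radical] by auto
  moreover have "br z w = br x1 x2 + (br x1 y2 + br y1 x2 + br y1 y2)"
    using V br_closed V_add by (simp add: p q br_add_left br_add_right algebra_simps)
  ultimately show ?thesis using A_facts(3) B_facts(3) by (auto simp: fiber_def)
qed

lemma isomorphic_M_tilde:
  "alg_isomorphic (alg_of s sum_AB br) (M_tilde s A br B br radical br pairing)"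
  unfolding alg_isomorphic_def
proof (intro exI[of _ fiber] conjI ballI allI)
  have quot: "M_tilde s A br B br radical br pairing =
      quot_alg (module_prod.scale s s) (A \<times> B) (M_prod br br radical br pairing) antidiagonal"
    by (simp add: M_tilde_def antidiagonal_def)
  have "fiber ` sum_AB = {p +o antidiagonal | p. p \<in> A \<times> B}"
    unfolding sum_AB_def using fiber_eq_coset by (auto simp: image_iff) metis+
  moreover have "inj_on fiber sum_AB"
  proof (rule inj_onI)
    fix z w assume "z \<in> sum_AB" "fiber z = fiber w"
    then obtain p where "p \<in> fiber z" "p \<in> fiber w" using fiber_nonempty by blast
    then show "z = w" by (auto simp: fiber_def)
  qed
  ultimately show "bij_betw fiber (car (alg_of s sum_AB br))
      (car (M_tilde s A br B br radical br pairing))"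
    by (simp add: bij_betw_def alg_of_def quot quot_alg_def)
next
  fix z w assume "z \<in> car (alg_of s sum_AB br)" "w \<in> car (alg_of s sum_AB br)"
  then have zw: "z \<in> sum_AB" "w \<in> sum_AB" by (auto simp: alg_of_def)
  have "fiber (z + w) = fiber z + fiber w"
  proof -
    obtain a b a' b' where z: "a \<in> A" "b \<in> B" "z = a + b" and w: "a' \<in> A" "b' \<in> B" "w = a' + b'"
      using zw by (auto simp: sum_AB_def)
    have "fiber w = (a', b') +o antidiagonal" "fiber z = (a, b) +o antidiagonal"
      using fiber_eq_coset z w by auto
    \<comment> \<open>Addition in \<open>quot_alg\<close> is the plain sum of cosets, so idempotence
      is needed; it holds because \<open>antidiagonal\<close> is the fiber over 0.\<close>
    moreover have "antidiagonal + antidiagonal = antidiagonal"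
      using fiber_absorb[of antidiagonal 0] fiber_eq_coset[of 0 0] subspace_0[OF A_facts(1)]
        subspace_0[OF B_facts(1)] subspace_0[OF subspace_radical]
      by (auto simp: zero_prod_def[symmetric] antidiagonal_def)
    moreover have "z + w = (a + a') + (b + b')" using z w by (simp add: algebra_simps)
    then have "fiber (z + w) = (a + a', b + b') +o antidiagonal"
      using fiber_eq_coset[of "a + a'" "b + b'"] z w subspace_add[OF A_facts(1)]
        subspace_add[OF B_facts(1)] by metis
    ultimately show ?thesis
      using set_plus_rearrange[of "(a, b)" antidiagonal "(a', b')" antidiagonal] by simp
  qed
  then show "fiber (add (alg_of s sum_AB br) z w) =
      add (M_tilde s A br B br radical br pairing) (fiber z) (fiber w)"
    by (simp add: alg_of_def M_tilde_def quot_alg_def)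
  have "{M_prod br br radical br pairing p q | p q. p \<in> fiber z \<and> q \<in> fiber w} + antidiagonal
      = fiber (br z w)"
  proof (rule fiber_absorb)
    obtain p q where "p \<in> fiber z" "q \<in> fiber w" using fiber_nonempty zw by blast
    then show "{M_prod br br radical br pairing p q | p q. p \<in> fiber z \<and> q \<in> fiber w} \<noteq> {}"
      by blast
    show "{M_prod br br radical br pairing p q | p q. p \<in> fiber z \<and> q \<in> fiber w}
        \<subseteq> fiber (br z w)"
      by (rule subsetI) (elim CollectE exE conjE, simp only: M_prod_fiber)
  qed
  then show "fiber (mul (alg_of s sum_AB br) z w) =
      mul (M_tilde s A br B br radical br pairing) (fiber z) (fiber w)"
    by (simp add: alg_of_def M_tilde_def quot_alg_def antidiagonal_def)
next
  fix t z assume "z \<in> car (alg_of s sum_AB br)"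
  then have z: "z \<in> sum_AB" by (auto simp: alg_of_def)
  interpret P: module_prod s s by unfold_locales
  have "module_prod.scale s s t ` fiber z + antidiagonal = fiber (s t z)"
    using fiber_nonempty[OF z] subspace_scale[OF A_facts(1)] subspace_scale[OF B_facts(1)]
    by (intro fiber_absorb) (auto simp: fiber_def P.scale_def scale_right_distrib)
  then show "fiber (scl (alg_of s sum_AB br) t z) =
      scl (M_tilde s A br B br radical br pairing) t (fiber z)"
    by (simp add: alg_of_def M_tilde_def quot_alg_def antidiagonal_def)
qed

end

section \<open>Extracting the form and the central vector from rank one\<close>

theorem theorem4:
  fixes s :: "complex \<Rightarrow> 'a::ab_group_add \<Rightarrow> 'a"
    and M0 :: "'a set"
    and br :: "'a \<Rightarrow> 'a \<Rightarrow> 'a"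
  assumes "vector_space s"
    and "symmetric_leibniz_algebra s M0 br"
    and "leibniz_rank s M0 br = 1"
  shows "\<exists>I. ideal_on s M0 br I \<and> vector_space.dim s M0 \<le> vector_space.dim s I + 1 \<and>
           (\<exists>L1 br1 L2 br2 R \<alpha> \<pi>. leibniz_data s L1 br1 L2 br2 R \<alpha> \<pi> \<and>
              alg_isomorphic (alg_of s I br) (M_tilde s L1 br1 L2 br2 R \<alpha> \<pi>))"
proof -
  interpret vector_space s by fact
  have alg: "algebra_on s M0 br"
    and left: "\<And>x y z. x \<in> M0 \<Longrightarrow> y \<in> M0 \<Longrightarrow> z \<in> M0 \<Longrightarrow>
      br x (br y z) = br (br x y) z + br y (br x z)"
    and right: "\<And>x y z. x \<in> M0 \<Longrightarrow> y \<in> M0 \<Longrightarrow> z \<in> M0 \<Longrightarrow>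
      br (br y z) x = br (br y x) z + br y (br z x)"
    using assms(2)
    unfolding symmetric_leibniz_algebra_def left_leibniz_algebra_def right_leibniz_algebra_def
      derivations_def by blast+
  obtain G where G: "finite G" "M0 = span G" using alg unfolding algebra_on_def by blast
  have sub: "subspace M0"
    and closed: "\<And>x y. x \<in> M0 \<Longrightarrow> y \<in> M0 \<Longrightarrow> br x y \<in> M0"
    and add_l: "\<And>x y z. x \<in> M0 \<Longrightarrow> y \<in> M0 \<Longrightarrow> z \<in> M0 \<Longrightarrow> br (x + y) z = br x z + br y z"
    and add_r: "\<And>x y z. x \<in> M0 \<Longrightarrow> y \<in> M0 \<Longrightarrow> z \<in> M0 \<Longrightarrow> br x (y + z) = br x y + br x z"
    and scale_l: "\<And>t x y. x \<in> M0 \<Longrightarrow> y \<in> M0 \<Longrightarrow> br (s t x) y = s t (br x y)"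
    and scale_r: "\<And>t x y. x \<in> M0 \<Longrightarrow> y \<in> M0 \<Longrightarrow> br x (s t y) = s t (br x y)"
    using alg unfolding algebra_on_def by blast+
  note M_add = subspace_add[OF sub] and M_scale = subspace_scale[OF sub] and M_0 = subspace_0[OF sub]
  have zero_l: "br 0 x = 0" and zero_r: "br x 0 = 0" if "x \<in> M0" for x
    using add_l[of 0 0 x] add_r[of x 0 0] M_0 that by auto

  let ?C = "leibniz_kernel s M0 br"
  let ?N = "{k \<in> M0. \<forall>x\<in>M0. br k x = 0 \<and> br x k = 0}"
  have "subspace ?N"
    unfolding subspace_def
    using M_add M_scale M_0 zero_l zero_r add_l add_r scale_l scale_r by auto
  \<comment> \<open>With a repeated argument \<open>a\<close>, a term of each Leibniz identity
    cancels: the left identity kills \<open>br (br a a) x\<close>, the right one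
    \<open>br x (br a a)\<close>.\<close>
  moreover have "{br a a | a. a \<in> M0} \<subseteq> ?N"
  proof -
    have "br (br a a) x = 0" "br x (br a a) = 0" if "a \<in> M0" "x \<in> M0" for a x
      using left[of a a x] right[of a x a] that by auto
    then show ?thesis using closed by blast
  qed
  ultimately have C_N: "?C \<subseteq> ?N"
    unfolding leibniz_kernel_def by (rule span_minimal[rotated])

  obtain K where K: "K \<subseteq> ?C" "independent K" "?C \<subseteq> span K" "card K = dim ?C"
    using basis_exists by blast
  then have "card K = 1" using assms(3) by (simp add: leibniz_rank_def)
  then obtain c where c: "K = {c}" using card_1_singletonE by blast
  have c0: "c \<noteq> 0" using K(2) c dependent_zero by blast
  have cN: "c \<in> ?N" using K(1) c C_N by blast
  have "br x y + br y x \<in> ?C" if "x \<in> M0" "y \<in> M0" for x y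
  proof -
    \<comment> \<open>Polarisation expresses symmetrised products through squares.\<close>
    have "br x y + br y x = br (x + y) (x + y) - br x x - br y y"
      using that M_add by (simp add: add_l add_r)
    also have "\<dots> \<in> ?C"
      unfolding leibniz_kernel_def using that M_add by (intro span_diff span_base) auto
    finally show ?thesis .
  qed
  then have "\<exists>t. br x y + br y x = s t c" if "x \<in> M0" "y \<in> M0" for x y
    using that K(3) unfolding c span_singleton by blast
  then obtain f where f: "\<And>x y. x \<in> M0 \<Longrightarrow> y \<in> M0 \<Longrightarrow> br x y + br y x = s (f x y) c"
    using that[of "\<lambda>x y. SOME t. br x y + br y x = s t c"] by (metis (mono_tags, lifting) someI_ex)
  \<comment> \<open>As \<open>c\<close> is nonzero, its coefficient is unique; every property of
    \<open>f\<close> is thus checked on symmetrised products.\<close>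
  have f_eqI: "f x y = t" if "x \<in> M0" "y \<in> M0" "br x y + br y x = s t c" for x y t
    using that f c0 by (metis scale_cancel_right)

  interpret symmetric_form s M0 f
  proof unfold_locales
    show "subspace M0" by (fact sub)
    show "f (x + y) z = f x z + f y z" if "x \<in> M0" "y \<in> M0" "z \<in> M0" for x y z
    proof (rule f_eqI)
      have "br (x + y) z + br z (x + y) = (br x z + br z x) + (br y z + br z y)"
        using that by (simp add: add_l add_r)
      also have "\<dots> = s (f x z + f y z) c" using f that by (simp add: scale_left_distrib)
      finally show "br (x + y) z + br z (x + y) = s (f x z + f y z) c" .
    qed (use that M_add in auto)
    show "f (s t x) y = t * f x y" if "x \<in> M0" "y \<in> M0" for t x y
    proof (rule f_eqI)
      have "br (s t x) y + br y (s t x) = s t (br x y + br y x)"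
        using that by (simp add: scale_l scale_r scale_right_distrib)
      then show "br (s t x) y + br y (s t x) = s (t * f x y) c" using f that by simp
    qed (use that M_scale in auto)
    show "f x y = f y x" if "x \<in> M0" "y \<in> M0" for x y
      using that f[of y x] by (intro f_eqI) (auto simp: add.commute)
  qed

  have f_br: "f x (br y z) = 0" if "x \<in> M0" "y \<in> M0" "z \<in> M0" for x y z
  proof (rule f_eqI)
    \<comment> \<open>Symmetrised products are multiples of the central \<open>c\<close>, so factors
      inside a nested product may be swapped at the cost of a sign. After that, the left and right
      expansions of the two summands cancel.\<close>
    have "br (br y x + br x y) z = 0"
      using f[of y x] that cN scale_l[of c z] by simp
    then have 1: "br (br y x) z = - br (br x y) z"
      using that closed by (simp add: add_l eq_neg_iff_add_eq_0)
    have "br y (br z x + br x z) = 0"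
      using f[of z x] that cN scale_r[of y c] by simp
    then have 2: "br y (br z x) = - br y (br x z)"
      using that closed by (simp add: add_r eq_neg_iff_add_eq_0)
    show "br x (br y z) + br (br y z) x = s 0 c"
      using left[of x y z] right[of x y z] 1 2 that by simp
  qed (use that closed in auto)

  have c_radical: "c \<in> radical"
    unfolding radical_def using cN f_eqI[of c _ 0] by auto
  have c_central: "br c x = 0" "br x c = 0" if "x \<in> M0" for x
    using cN that by auto
  obtain A B e where pair: "isotropic_pair A B e" using isotropic_pair_exists[OF G] by blast
  interpret split_symmetric_leibniz s M0 f br G c A B e
    by unfold_locales
      (fact G closed add_l add_r scale_l scale_r left f f_br c0 c_radical c_central pair)+
  show ?thesis
    using ideal_sum_AB codim_sum_AB leibniz_data isomorphic_M_tilde by blast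
qed

end
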